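(* Let $a=(a_n)_{n\in\mathbb{N}}$ and $b=(b_n)_{n\in\mathbb{N}}$ be sequences of positive integers, set $a_0=b_0=0$, and suppose the set $\{(a_n,b_n)\mid n\in\mathbb{N}_0\}$ is $b_1$-superadditive-complementary ($b_1$-SAC). Let $G$ be the invariant subtraction game on $\mathbb{N}_0\times\mathbb{N}_0$ with set of moves $\mathcal{M}(G)=\{\{a_n,b_n\}\mid n\in\mathbb{N}\}$. Then $$\mathcal{P}(G^\star)=\mathcal{M}(G)\cup\{(0,0)\}$$ and $(G^\star)^\star=G$.
   Context: $\mathbb{N}$ denotes the positive integers, $\mathbb{N}_0$ the non-negative integers. The game board is $\mathbb{N}_0^2$ with componentwise addition $\oplus$, componentwise subtraction $\ominus$ (defined when $\boldsymbol y\preceq\boldsymbol x$), and componentwise partial order $\preceq$; $\boldsymbol y\prec\boldsymbol x$ means $\boldsymbol y\preceq\boldsymbol x$ and $\boldsymbol y\neq\boldsymbol x$. A (2-pile subtraction) game assigns to each position $\boldsymbol x$ a set of options $F(\boldsymbol x)$ with $\boldsymbol y\in F(\boldsymbol x)\Rightarrow\boldsymbol y\prec\boldsymbol x$; two players alternately move from the current position to an option, and the player making the last move wins. A game is invariant if for all $\boldsymbol x,\boldsymbol y$ and $\boldsymbol r\neq\boldsymbol 0$, $\boldsymbol x\oplus\boldsymbol r\to\boldsymbol x$ is an option whenever $\boldsymbol y\oplus\boldsymbol r\to\boldsymbol y$ is; its set of moves is $\mathcal{M}(G)=\{\boldsymbol r\mid \boldsymbol 0\in F(\boldsymbol r)\}$,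 and then the options of $\boldsymbol x$ are exactly $\boldsymbol x\ominus\boldsymbol r$ for $\boldsymbol r\in\mathcal{M}(G)$ with $\boldsymbol r\preceq\boldsymbol x$; an invariant game is determined by its set of moves. A position is a $P$-position if all its options are $N$-positions, and an $N$-position otherwise; $\mathcal{P}(G)$, $\mathcal{N}(G)$ denote these sets. For any game $G$, $G^\star$ is the invariant game with $\mathcal{M}(G^\star)=\mathcal{P}(G)\setminus\{(0,0)\}$. The notation $\{r,s\}$ for a pair means both ordered pairs $(r,s)$ and $(s,r)$; e.g. $\mathcal{M}(G)=\{\{a_n,b_n\}\}$ means $\mathcal{M}(G)=\{(a_n,b_n),(b_n,a_n)\mid n\in\mathbb{N}\}$. Sequences $(x_n)_{n\in\mathbb{N}}$, $(y_n)_{n\in\mathbb{N}}$ of positive integers are complementary if $\{x_n\}\cup\{y_n\}=\mathbb{N}$ and $\{x_n\}\cap\{y_n\}=\emptyset$. For $t\in\mathbb{N}$, a sequence $(X_n)_{n\in\mathbb{N}_0}$ is $t$-superadditive if $X_m+X_n\le X_{m+n}<X_m+X_n+t$ for all $m,n\in\mathbb{N}_0$. With $a_0=b_0=0$, the set $\{(a_n,b_n)\mid n\in\mathbb{N}_0\}$ is $t$-SAC if: $a_1=1$; $(a_n)_{n\in\mathbb{N}}$ and $(b_n)_{n\in\mathbb{N}}$ are complementary; $a$ is increasing; and $(b_n)_{n\in\mathbb{N}_0}$ is $t$-superadditive. *)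

theory Defs
  imports Main "HOL-Library.Product_Plus" "HOL-Library.Product_Order"
begin

text \<open>
  Positions are pairs of natural numbers. The instances from the two imported theories make
  \<open>+\<close>, \<open>-\<close>, \<open>0\<close> and \<open>\<le>\<close> componentwise on pairs, and \<open>y < x\<close> means \<open>y \<le> x\<close> and \<open>y \<noteq> x\<close>.
  Componentwise \<open>-\<close> truncates on \<open>nat\<close>, so \<open>x - r\<close> is only used when \<open>r \<le> x\<close>.
\<close>

type_synonym position = "nat \<times> nat"

text \<open>A game is its option map, so equality of games is equality of option maps.\<close>

typedef game = "{F :: position \<Rightarrow> position set. \<forall>x y. y \<in> F x \<longrightarrow> y < x}"
  morphisms opts Game
  by (rule exI[of _ "\<lambda>_. {}"]) simp

lemma opts_less: "y \<in> opts G x \<Longrightarrow> y < x"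
  using opts[of G] by blast

definition is_invariant :: "game \<Rightarrow> bool" where
  "is_invariant G \<longleftrightarrow> (\<forall>x y r. r \<noteq> 0 \<longrightarrow> y \<in> opts G (y + r) \<longrightarrow> x \<in> opts G (x + r))"

definition moves :: "game \<Rightarrow> position set" where
  "moves G = {r. 0 \<in> opts G r}"

function P_pos :: "game \<Rightarrow> position \<Rightarrow> bool" where
  "P_pos G x \<longleftrightarrow> (\<forall>y \<in> opts G x. \<not> P_pos G y)"
  by pat_completeness auto
termination
proof (relation "measure (\<lambda>(G, x). fst x + snd x)")
  fix G x y assume "y \<in> opts G x"
  then have "y < x" by (rule opts_less)
  then show "((G, y), (G, x)) \<in> measure (\<lambda>(G, x). fst x + snd x)"
    by (cases x; cases y) (auto simp: less_prod_def)
qed simp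

declare P_pos.simps [simp del]

definition P_positions :: "game \<Rightarrow> position set" where
  "P_positions G = {x. P_pos G x}"

definition N_positions :: "game \<Rightarrow> position set" where
  "N_positions G = - P_positions G"

lemma P_positions_iff: "x \<in> P_positions G \<longleftrightarrow> opts G x \<subseteq> N_positions G"
  unfolding P_positions_def N_positions_def mem_Collect_eq by (subst P_pos.simps) blast

text \<open>The zero vector cannot be a move, hence the guard.\<close>

definition invariant_game :: "position set \<Rightarrow> game" where
  "invariant_game M = Game (\<lambda>x. {x - r | r. r \<in> M \<and> r \<noteq> 0 \<and> r \<le> x})"

lemma diff_less_position: "r \<noteq> 0 \<Longrightarrow> r \<le> x \<Longrightarrow> x - r < x" for r x :: position
  by (cases r; cases x) (auto simp: less_prod_def zero_prod_def)

lemma opts_invariant_game: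
  "opts (invariant_game M) x = {x - r | r. r \<in> M \<and> r \<noteq> 0 \<and> r \<le> x}"
proof -
  have "(\<lambda>x. {x - r | r. r \<in> M \<and> r \<noteq> 0 \<and> r \<le> x})
      \<in> {F :: position \<Rightarrow> position set. \<forall>x y. y \<in> F x \<longrightarrow> y < x}"
    using diff_less_position by blast
  then show ?thesis
    unfolding invariant_game_def by (simp only: Game_inverse)
qed

lemma opts_invariant_game_iff:
  "x \<in> opts (invariant_game M) (x + r) \<longleftrightarrow> r \<in> M \<and> r \<noteq> 0"
proof -
  have key: "x = x + r - s \<and> s \<le> x + r \<longleftrightarrow> s = r" for s
    by (cases r; cases x; cases s) auto
  show ?thesis
    unfolding opts_invariant_game mem_Collect_eq using key by metis
qed

lemma invariant_game_is_invariant: "is_invariant (invariant_game M)"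
  unfolding is_invariant_def by (simp add: opts_invariant_game_iff)

lemma moves_invariant_game: "moves (invariant_game M) = M - {0}"
  unfolding moves_def using opts_invariant_game_iff[of 0] by auto

lemma is_invariant_determined:
  assumes "is_invariant G" and "is_invariant H" and "moves G = moves H"
  shows "G = H"
proof -
  have *: "y \<in> opts K x \<longleftrightarrow> y < x \<and> x - y \<in> moves K" if K: "is_invariant K" for K x y
  proof (cases "y < x")
    case True
    then have eq: "y + (x - y) = x" and nz: "x - y \<noteq> 0"
      by (cases x; cases y; auto simp: less_prod_def zero_prod_def)+
    have "y \<in> opts K (y + (x - y)) \<longleftrightarrow> 0 \<in> opts K (0 + (x - y))"
      using K nz unfolding is_invariant_def by blast
    with True eq show ?thesis by (simp add: moves_def)
  next
    case False
    then show ?thesis using opts_less by blast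
  qed
  have "opts G = opts H"
    using assms by (intro ext set_eqI) (simp add: *)
  then show ?thesis by (simp add: opts_inject)
qed

definition star :: "game \<Rightarrow> game" where
  "star G = invariant_game (P_positions G - {(0, 0)})"

lemma star_unique:
  "H = star G \<longleftrightarrow> is_invariant H \<and> moves H = P_positions G - {(0, 0)}"
proof -
  have "is_invariant (star G)" "moves (star G) = P_positions G - {(0, 0)}"
    by (simp_all add: star_def invariant_game_is_invariant moves_invariant_game zero_prod_def)
  then show ?thesis using is_invariant_determined[of H "star G"] by auto
qed

definition complementary :: "(nat \<Rightarrow> nat) \<Rightarrow> (nat \<Rightarrow> nat) \<Rightarrow> bool" where
  "complementary x y \<longleftrightarrow> x ` {1..} \<union> y ` {1..} = {1..} \<and> x ` {1..} \<inter> y ` {1..} = {}"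

definition superadditive :: "nat \<Rightarrow> (nat \<Rightarrow> nat) \<Rightarrow> bool" where
  "superadditive t X \<longleftrightarrow> (\<forall>m n. X m + X n \<le> X (m + n) \<and> X (m + n) < X m + X n + t)"

text \<open>``Increasing'' is read as strictly increasing.\<close>

definition SAC :: "nat \<Rightarrow> (nat \<Rightarrow> nat) \<Rightarrow> (nat \<Rightarrow> nat) \<Rightarrow> bool" where
  "SAC t a b \<longleftrightarrow> a 0 = 0 \<and> b 0 = 0 \<and> a 1 = 1 \<and> complementary a b \<and>
     strict_mono_on {1..} a \<and> superadditive t b"

end

theory Submission
  imports Defs
begin

text \<open>
  Write \<open>M\<close> for the moves of \<open>G\<close>. A position \<open>x\<close> outside \<open>M \<union> {0}\<close> has an option of \<open>G\<^sup>\<star>\<close> in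
  \<open>M \<union> {0}\<close> for free: a \<open>P\<close>-position \<open>x \<noteq> 0\<close> of \<open>G\<close> is itself a move of \<open>G\<^sup>\<star>\<close> from \<open>x\<close> to \<open>0\<close>; and if
  \<open>x\<close> is an \<open>N\<close>-position of \<open>G\<close>, then some \<open>m \<in> M\<close> leads to a \<open>P\<close>-position \<open>x - m \<noteq> 0\<close>, so that
  \<open>x - m\<close> is a move of \<open>G\<^sup>\<star>\<close> from \<open>x\<close> to \<open>m\<close>. So the theorem amounts to showing that the
  difference of two distinct comparable moves of \<open>G\<close> is an \<open>N\<close>-position of \<open>G\<close>.

  Writing \<open>a n = n + k\<close> with \<open>b k < a n < b (k + 1)\<close>, superadditivity of \<open>b\<close> confines
  \<open>a (p + q) - a p - a q\<close> to \<open>{-1, 0, 1}\<close>. If it is nonnegative, the move \<open>(a q, b q)\<close> takes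
  \<open>(a (p + q) - a p, b (p + q) - b p)\<close> into the square \<open>[0, b 1)\<^sup>2\<close>, where \<open>G\<close> has no moves. In
  all remaining cases some move empties one of the piles, and then the game is over as well.
\<close>

section \<open>P-positions of invariant games and of their star games\<close>

lemma P_positions_eqI:
  assumes "\<And>x. x \<in> S \<longleftrightarrow> opts G x \<inter> S = {}"
  shows "P_positions G = S"
proof -
  \<comment> \<open>Options have a smaller coordinate sum, so at most one set can satisfy the
    assumed recursion.\<close>
  have "P_pos G x \<longleftrightarrow> x \<in> S" for x
  proof (induction "fst x + snd x" arbitrary: x rule: less_induct)
    case less
    have "P_pos G y \<longleftrightarrow> y \<in> S" if "y \<in> opts G x" for y
      using opts_less[OF that] by (intro less) (cases x; cases y; auto simp: less_prod_def)
    then show ?case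
      using assms[of x] by (subst P_pos.simps) blast
  qed
  then show ?thesis
    by (auto simp: P_positions_def)
qed

lemma zero_notin_moves: "0 \<notin> moves G"
  using opts_less[of 0 G 0] by (auto simp: moves_def)

lemma opts_of_invariant:
  assumes "is_invariant G"
  shows "opts G x = {x - r | r. r \<in> moves G \<and> r \<le> x}"
proof -
  have "G = invariant_game (moves G)"
    by (rule is_invariant_determined)
      (use assms zero_notin_moves in \<open>auto simp: invariant_game_is_invariant moves_invariant_game\<close>)
  then have "opts G x = {x - r | r. r \<in> moves G \<and> r \<noteq> 0 \<and> r \<le> x}"
    by (metis opts_invariant_game)
  then show ?thesis
    using zero_notin_moves[of G] by (auto 0 3 simp del: split_paired_All split_paired_Ex)
qed

lemma zero_in_P_positions: "(0, 0) \<in> P_positions G"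
proof -
  have "opts G (0, 0) = {}"
    using opts_less[of _ G "(0, 0)"] by (auto simp: less_prod_def)
  then show ?thesis
    by (simp add: P_positions_iff)
qed

lemma P_positions_star:
  assumes inv: "is_invariant G"
    and diff: "\<And>x y. \<lbrakk>x \<in> moves G; y \<in> moves G; y < x\<rbrakk> \<Longrightarrow> x - y \<notin> P_positions G"
  shows "P_positions (star G) = moves G \<union> {(0, 0)}"
proof (rule P_positions_eqI)
  fix x :: position
  have star_opts: "opts (star G) x = {x - r | r. r \<in> P_positions G \<and> r \<noteq> 0 \<and> r \<le> x}"
    by (auto simp: star_def opts_invariant_game zero_prod_def)
  show "x \<in> moves G \<union> {(0, 0)} \<longleftrightarrow> opts (star G) x \<inter> (moves G \<union> {(0, 0)}) = {}"
  proof
    assume x: "x \<in> moves G \<union> {(0, 0)}"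
    have "x - r \<notin> moves G \<union> {(0, 0)}" if r: "r \<in> P_positions G" "r \<noteq> 0" "r \<le> x" for r
    proof
      assume y: "x - r \<in> moves G \<union> {(0, 0)}"
      \<comment> \<open>\<open>r\<close> is the difference of \<open>x\<close> and the position
        reached, which lets \<open>diff\<close> exclude it. If that position is 0, then
        \<open>r = x\<close> is a move of \<open>G\<close> and hence an N-position.\<close>
      have lt: "x - r < x" and r_eq: "x - (x - r) = r"
        using r diff_less_position by (cases x; cases r; auto)+
      have xM: "x \<in> moves G"
        using x r by (cases r) (auto simp: zero_prod_def)
      show False
      proof (cases "x - r = 0")
        case True
        then have "0 \<in> opts G r"
          using xM r r_eq by (simp add: moves_def)
        then show ?thesis
          using r(1) zero_in_P_positions[of G]
          by (auto simp: P_positions_iff[of r] N_positions_def zero_prod_def)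
      next
        case False
        then show ?thesis
          using diff[OF xM _ lt] y r r_eq by (auto simp: zero_prod_def)
      qed
    qed
    then show "opts (star G) x \<inter> (moves G \<union> {(0, 0)}) = {}"
      unfolding star_opts by blast
  next
    assume empty: "opts (star G) x \<inter> (moves G \<union> {(0, 0)}) = {}"
    show "x \<in> moves G \<union> {(0, 0)}"
    proof (rule ccontr)
      assume x: "x \<notin> moves G \<union> {(0, 0)}"
      show False
      proof (cases "x \<in> P_positions G")
        case True
        then have "x - x \<in> opts (star G) x"
          using x unfolding star_opts zero_prod_def by blast
        then show ?thesis
          using empty by (simp add: zero_prod_def)
      next
        case False
        then obtain m where m: "m \<in> moves G" "m \<le> x" "x - m \<in> P_positions G"
          unfolding P_positions_iff[of x] opts_of_invariant[OF inv] N_positions_def by blast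
        have "x - m \<noteq> 0"
        proof
          assume "x - m = 0"
          then have "x = m"
            using m(2) by (cases x; cases m) (auto simp: zero_prod_def)
          then show False
            using m x by simp
        qed
        moreover have "m = x - (x - m)" "x - m \<le> x"
          using m(2) by (cases x; cases m; auto)+
        ultimately have "m \<in> opts (star G) x"
          using m(3) unfolding star_opts mem_Collect_eq by blast
        then show ?thesis
          using empty m(1) by blast
      qed
    qed
  qed
qed

lemma star_star_eq:
  assumes "is_invariant G" and "P_positions (star G) = moves G \<union> {(0, 0)}"
  shows "star (star G) = G"
proof -
  have "moves G = P_positions (star G) - {(0, 0)}"
    using assms(2) zero_notin_moves[of G] by (auto simp: zero_prod_def)
  then show ?thesis
    using assms(1) star_unique[of G "star G"] by simp
qed

text \<open>Reflection carries options to options, so the reflected set of P-positions satisfies the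
  same recursion.\<close>

lemma P_positions_swap:
  assumes inv: "is_invariant G"
    and sym: "\<And>r. r \<in> moves G \<Longrightarrow> prod.swap r \<in> moves G"
  shows "prod.swap x \<in> P_positions G \<longleftrightarrow> x \<in> P_positions G"
proof -
  have swap_opts: "prod.swap y \<in> opts G (prod.swap x)" if y: "y \<in> opts G x" for x y
  proof -
    obtain r where r: "y = x - r" "r \<in> moves G" "r \<le> x"
      using y unfolding opts_of_invariant[OF inv] by blast
    have "prod.swap y = prod.swap x - prod.swap r" "prod.swap r \<le> prod.swap x"
      using r by (cases x; cases r; auto)+
    then show ?thesis
      using sym[OF r(2)] unfolding opts_of_invariant[OF inv] by blast
  qed
  have opts_iff: "prod.swap y \<in> opts G x \<longleftrightarrow> y \<in> opts G (prod.swap x)" for x y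
    using swap_opts[of "prod.swap y" x] swap_opts[of y "prod.swap x"] by auto
  have "P_positions G = prod.swap ` P_positions G"
  proof (rule P_positions_eqI)
    fix x
    have mem: "y \<in> prod.swap ` P_positions G \<longleftrightarrow> prod.swap y \<in> P_positions G" for y
      by force
    have "prod.swap x \<in> P_positions G \<longleftrightarrow> (\<forall>y \<in> opts G (prod.swap x). y \<notin> P_positions G)"
      unfolding P_positions_iff[of "prod.swap x"] N_positions_def by blast
    also have "\<dots> \<longleftrightarrow> (\<forall>y \<in> opts G x. prod.swap y \<notin> P_positions G)"
      by (metis opts_iff swap_swap)
    finally show "x \<in> prod.swap ` P_positions G \<longleftrightarrow> opts G x \<inter> prod.swap ` P_positions G = {}"
      using mem by blast
  qed
  then show ?thesis
    by (metis image_eqI swap_swap)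
qed

section \<open>Arithmetic of superadditive complementary pairs\<close>

locale SAC_pair =
  fixes a b :: "nat \<Rightarrow> nat"
  assumes SAC: "SAC (b 1) a b"
begin

lemma b_0: "b 0 = 0" and a_1: "a 1 = 1"
  using SAC by (auto simp: SAC_def)

lemma superadd_lower: "b m + b n \<le> b (m + n)"
  and superadd_upper: "b (m + n) < b m + b n + b 1"
  using SAC by (auto simp: SAC_def superadditive_def)

lemma a_less: "1 \<le> m \<Longrightarrow> m < n \<Longrightarrow> a m < a n"
  using SAC by (auto simp: SAC_def strict_mono_on_def)

lemma a_neq_b: "1 \<le> m \<Longrightarrow> 1 \<le> n \<Longrightarrow> a m \<noteq> b n"
  using SAC by (force simp: SAC_def complementary_def)

lemma a_pos: "1 \<le> n \<Longrightarrow> 1 \<le> a n" and b_pos: "1 \<le> n \<Longrightarrow> 1 \<le> b n"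
  using SAC unfolding SAC_def complementary_def by (metis UnI1 UnI2 atLeast_iff image_eqI)+

lemma a_or_b_cases:
  assumes "1 \<le> i"
  obtains s where "1 \<le> s" "i = a s" | s where "1 \<le> s" "i = b s"
proof -
  have "i \<in> a ` {1..} \<union> b ` {1..}"
    using SAC assms by (simp add: SAC_def complementary_def)
  then show ?thesis
    using that by auto
qed

lemma b_1_ge_2: "2 \<le> b 1"
  using a_neq_b[of 1 1] a_1 b_pos[of 1] by linarith

lemma b_Suc: "b n + b 1 \<le> b (Suc n)"
  using superadd_lower[of n 1] by simp

lemma b_strict_mono: "strict_mono b"
proof (unfold strict_mono_Suc_iff, intro allI)
  fix n
  show "b n < b (Suc n)"
    using b_Suc[of n] b_1_ge_2 by linarith
qed

lemma b_mono: "m \<le> n \<Longrightarrow> b m \<le> b n"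
  using b_strict_mono by (simp add: strict_mono_less_eq)

lemma a_less_iff: "1 \<le> m \<Longrightarrow> 1 \<le> n \<Longrightarrow> a m < a n \<longleftrightarrow> m < n"
  using a_less[of m n] a_less[of n m] by (cases m n rule: linorder_cases) auto

text \<open>\<open>k\<close> counts the terms of \<open>b\<close> below \<open>a n\<close>.\<close>

lemma a_decomp:
  assumes "1 \<le> n"
  shows "\<exists>k. a n = n + k \<and> b k < n + k \<and> n + k < b (Suc k)"
  using assms
proof (induction n rule: dec_induct)
  case base
  show ?case
    using a_1 b_0 b_1_ge_2 by (intro exI[of _ 0]) auto
next
  case (step n)
  then obtain k where k: "a n = n + k" "b k < n + k" "n + k < b (Suc k)"
    by blast
  \<comment> \<open>By complementarity such a \<open>v\<close> is a term of \<open>a\<close> whose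
    index exceeds \<open>n\<close>.\<close>
  have next_le: "a (Suc n) \<le> v" if v: "a n < v" "\<And>s. v \<noteq> b s" for v
  proof -
    have "1 \<le> v"
      using v(1) by simp
    then obtain s where s: "1 \<le> s" "v = a s"
      by (rule a_or_b_cases) (use v(2) in blast)+
    then have "n < s"
      using v step.hyps a_less_iff by simp
    then have "Suc n = s \<or> Suc n < s"
      by linarith
    then show ?thesis
      using s a_less[of "Suc n" s] by auto
  qed
  have gap: "v \<noteq> b s" if "b j < v" "v < b (Suc j)" for v j s
    using that strict_mono_less[OF b_strict_mono, of j s]
      strict_mono_less[OF b_strict_mono, of s "Suc j"]
    by auto
  have lt: "a n < a (Suc n)"
    using a_less step.hyps by simp
  show ?case
  \<comment> \<open>Either the next integer is not a term of \<open>b\<close>, or it equals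
    \<open>b (Suc k)\<close> and \<open>a\<close> skips only this value, because gaps in
    \<open>b\<close> are at least 2.\<close>
  proof (cases "Suc (n + k) < b (Suc k)")
    case True
    then have "a (Suc n) \<le> Suc (n + k)"
      using k by (intro next_le gap[of k]) auto
    then show ?thesis
      using k lt True by (intro exI[of _ k]) auto
  next
    case False
    then have eq: "b (Suc k) = Suc (n + k)"
      using k by linarith
    have "Suc (Suc (n + k)) < b (Suc (Suc k))"
      using b_Suc[of "Suc k"] b_1_ge_2 eq by linarith
    moreover from this have "a (Suc n) \<le> Suc (Suc (n + k))"
      using k eq by (intro next_le gap[of "Suc k"]) auto
    moreover have "a (Suc n) \<noteq> b (Suc k)"
      by (rule a_neq_b) auto
    ultimately show ?thesis
      using k lt eq by (intro exI[of _ "Suc k"]) auto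
  qed
qed

text \<open>With \<open>k\<close>, \<open>l\<close>, \<open>j\<close> from \<open>a_decomp\<close>
  for \<open>p\<close>, \<open>q\<close>, \<open>p + q\<close>, the defect
  \<open>a (p + q) - a p - a q\<close> is \<open>j - k - l\<close>. Too large a \<open>j\<close>
  contradicts \<open>superadd_lower\<close>, too small a \<open>j\<close> contradicts
  \<open>superadd_upper\<close>.\<close>

lemma a_add_bounds:
  assumes p: "1 \<le> p" and q: "1 \<le> q"
  shows "a (p + q) \<le> a p + a q + 1" and "a p + a q \<le> a (p + q) + 1"
proof -
  obtain k where k: "a p = p + k" "b k < p + k" "p + k < b (Suc k)"
    using a_decomp p by blast
  obtain l where l: "a q = q + l" "b l < q + l" "q + l < b (Suc l)"
    using a_decomp q by blast
  obtain j where j: "a (p + q) = p + q + j" "b j < p + q + j" "p + q + j < b (Suc j)"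
    using a_decomp[of "p + q"] p by auto
  have step: "b m + d \<le> b (m + d)" for m d
  proof (induction d)
    case (Suc d)
    then show ?case
      using b_Suc[of "m + d"] b_1_ge_2 by simp
  qed simp
  have "j < k + l + 2"
  proof (rule ccontr)
    assume "\<not> j < k + l + 2"
    then obtain d where d: "j = k + l + 2 + d"
      using le_Suc_ex not_less by blast
    have "b (Suc k) + b (Suc l) \<le> b (k + l + 2)"
      using superadd_lower[of "Suc k" "Suc l"] by simp
    then show False
      using step[of "k + l + 2" d] d k l j by simp
  qed
  moreover have "k + l \<le> j + 1"
  proof (rule ccontr)
    assume "\<not> k + l \<le> j + 1"
    then obtain d where d: "k + l = Suc (Suc j) + d"
      using le_Suc_ex[of "Suc (Suc j)" "k + l"] by auto
    have "b (k + l) < b k + b l + b 1"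
      by (rule superadd_upper)
    \<comment> \<open>The jump of at least \<open>b 1\<close> from \<open>b (Suc j)\<close> to
      \<open>b (Suc (Suc j))\<close> cancels the slack \<open>b 1\<close> of the upper
      bound.\<close>
    then show False
      using step[of "Suc (Suc j)" d] b_Suc[of "Suc j"] d k l j by simp
  qed
  ultimately show "a (p + q) \<le> a p + a q + 1" and "a p + a q \<le> a (p + q) + 1"
    using j k l by auto
qed

text \<open>Since \<open>2 * k \<le> b k < n + k\<close>, the count \<open>k\<close> is below
  \<open>n\<close>, so \<open>n + k < 2 * n \<le> b n\<close>.\<close>

lemma a_less_b:
  assumes "1 \<le> n"
  shows "a n < b n"
proof -
  obtain k where k: "a n = n + k" "b k < n + k"
    using a_decomp assms by blast
  have double: "2 * m \<le> b m" for m
  proof (induction m)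
    case (Suc m)
    then show ?case
      using b_Suc[of m] b_1_ge_2 by simp
  qed simp
  show ?thesis
    using double[of k] double[of n] k by linarith
qed

end

section \<open>Differences of moves are N-positions\<close>

locale SAC_game = SAC_pair a b for a b +
  fixes G :: game
  assumes inv: "is_invariant G"
    and moves_eq: "moves G = {(a n, b n) | n. n \<ge> 1} \<union> {(b n, a n) | n. n \<ge> 1}"
begin

lemma move_ab: "1 \<le> n \<Longrightarrow> (a n, b n) \<in> moves G"
  and move_ba: "1 \<le> n \<Longrightarrow> (b n, a n) \<in> moves G"
  by (auto simp: moves_eq)

lemma swap_P_iff: "prod.swap x \<in> P_positions G \<longleftrightarrow> x \<in> P_positions G"
  by (rule P_positions_swap[OF inv]) (auto simp: moves_eq)

lemma no_move_imp_P:
  assumes "\<And>r. r \<in> moves G \<Longrightarrow> \<not> r \<le> x"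
  shows "x \<in> P_positions G"
  using assms unfolding P_positions_iff opts_of_invariant[OF inv] by blast

lemma empty_pile_P: "(0, j) \<in> P_positions G"
proof (rule no_move_imp_P)
  fix r
  assume "r \<in> moves G"
  then obtain n where "1 \<le> n" "r = (a n, b n) \<or> r = (b n, a n)"
    by (auto simp: moves_eq)
  then show "\<not> r \<le> (0, j)"
    using a_pos[of n] b_pos[of n] by auto
qed

text \<open>Every move has some \<open>b n\<close> as a component, and \<open>b n\<close> is at
  least \<open>b 1\<close>.\<close>

lemma small_square_P:
  assumes "i < b 1" "j < b 1"
  shows "(i, j) \<in> P_positions G"
proof (rule no_move_imp_P)
  fix r
  assume "r \<in> moves G"
  then obtain n where "1 \<le> n" "r = (a n, b n) \<or> r = (b n, a n)"
    by (auto simp: moves_eq)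
  then show "\<not> r \<le> (i, j)"
    using b_mono[of 1 n] assms by auto
qed

lemma not_P_if_move_to_P:
  assumes "(r, s) \<in> moves G" "r \<le> i" "s \<le> j" "(i - r, j - s) \<in> P_positions G"
  shows "(i, j) \<notin> P_positions G"
proof -
  have "(i, j) - (r, s) \<in> opts G (i, j)"
    using assms unfolding opts_of_invariant[OF inv] by fastforce
  then show ?thesis
    using assms(4) unfolding P_positions_iff[of "(i, j)"] N_positions_def by auto
qed

text \<open>The move empties the first pile, which ends the game because both components of any move
  are positive.\<close>

lemma not_P_if_partner_le:
  assumes "(i, s) \<in> moves G" "s \<le> j"
  shows "(i, j) \<notin> P_positions G"
  using assms empty_pile_P by (intro not_P_if_move_to_P[of i s]) auto

lemma diff_same_orientation_not_P:
  assumes "1 \<le> n" "n < m"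
  shows "(a m - a n, b m - b n) \<notin> P_positions G"
proof -
  define q where "q = m - n"
  have q: "1 \<le> q" and m: "m = n + q"
    using assms by (auto simp: q_def)
  note bounds = a_add_bounds[OF \<open>1 \<le> n\<close> q, folded m]
  have b_low: "b n + b q \<le> b m" and b_up: "b m < b n + b q + b 1"
    using superadd_lower superadd_upper m by auto
  show ?thesis
  proof (cases "a n + a q \<le> a m")
    case True
    \<comment> \<open>After the move \<open>(a q, b q)\<close> the first pile holds at most 1, which
      is below \<open>b 1\<close>.\<close>
    then show ?thesis
      using bounds b_low b_up b_1_ge_2
      by (intro not_P_if_move_to_P[OF move_ab[OF q]] small_square_P) auto
  next
    case False
    \<comment> \<open>Whichever sequence contains \<open>a q - 1\<close>, its partner is at most
      \<open>b q\<close> and so fits into the second pile.\<close>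
    then have i: "a m - a n = a q - 1"
      using bounds by linarith
    have "1 \<le> a m - a n"
      using a_less[OF assms] by linarith
    then show ?thesis
    proof (cases rule: a_or_b_cases)
      case (1 s)
      then have "a s < a q"
        using i a_pos[OF q] by linarith
      then have "b s \<le> b q"
        using a_less_iff 1 q by (intro b_mono) auto
      then show ?thesis
        using 1 b_low move_ab[of s] by (intro not_P_if_partner_le[of _ "b s"]) auto
    next
      case (2 s)
      then have "a s \<le> b q"
        using i a_less_b[of s] a_less_b[OF q] by linarith
      then show ?thesis
        using 2 b_low move_ba[of s] by (intro not_P_if_partner_le[of _ "a s"]) auto
    qed
  qed
qed

text \<open>By complementarity the first pile is nonempty and equals some \<open>a s\<close> or
  \<open>b s\<close>; the partner of that term fits into the second pile.\<close>

lemma diff_opposite_orientation_not_P: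
  assumes n: "1 \<le> n" and m: "1 \<le> m" and le: "b n \<le> a m"
  shows "(a m - b n, b m - a n) \<notin> P_positions G"
proof -
  have "1 \<le> a m - b n"
    using a_neq_b[OF m n] le by linarith
  then show ?thesis
  proof (cases rule: a_or_b_cases)
    case (1 s)
    then have "a s < a m"
      using b_pos[OF n] le by linarith
    then have s: "s < m"
      using a_less_iff 1 m by simp
    then have ms: "1 \<le> m - s"
      by simp
    \<comment> \<open>The 1 lost in this bound is regained from \<open>a n < b n\<close>.\<close>
    have "a m \<le> a s + a (m - s) + 1"
      using a_add_bounds(1)[OF 1(1) ms] s by simp
    then have "a n \<le> b (m - s)"
      using 1 le a_less_b[OF n] a_less_b[OF ms] by linarith
    then have "b s \<le> b m - a n"
      using superadd_lower[of s "m - s"] s by simp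
    then show ?thesis
      using 1 move_ab[of s] by (intro not_P_if_partner_le) auto
  next
    case (2 s)
    \<comment> \<open>Here \<open>a s + a n < b s + b n = a m < b m\<close>.\<close>
    then have "a s \<le> b m - a n"
      using le a_less_b[of s] a_less_b[OF n] a_less_b[OF m] by linarith
    then show ?thesis
      using 2 move_ba[of s] by (intro not_P_if_partner_le) auto
  qed
qed

lemma diff_moves_not_P:
  assumes x: "x \<in> moves G" and y: "y \<in> moves G" and less: "y < x"
  shows "x - y \<notin> P_positions G"
proof -
  \<comment> \<open>Reflection reduces the other orientation of \<open>x\<close> to this
    one.\<close>
  have main: "(a m, b m) - y \<notin> P_positions G"
    if m: "1 \<le> m" and y: "y \<in> moves G" and less: "y < (a m, b m)" for m y
  proof -
    consider n where "1 \<le> n" "y = (a n, b n)" | n where "1 \<le> n" "y = (b n, a n)"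
      using y by (auto simp: moves_eq)
    then show ?thesis
    proof cases
      case (1 n)
      then have "a n \<le> a m" "n \<noteq> m"
        using less by (auto simp: less_prod_def)
      then have "n < m"
        using a_less_iff[of m n] 1 m by linarith
      then show ?thesis
        using diff_same_orientation_not_P 1 by simp
    next
      case (2 n)
      then show ?thesis
        using diff_opposite_orientation_not_P[of n m] m less by (auto simp: less_prod_def)
    qed
  qed
  consider m where "1 \<le> m" "x = (a m, b m)" | m where "1 \<le> m" "x = (b m, a m)"
    using x by (auto simp: moves_eq)
  then show ?thesis
  proof cases
    case (1 m)
    then show ?thesis
      using main y less by simp
  next
    case (2 m)
    have "prod.swap y \<in> moves G" "prod.swap y < (a m, b m)"
      using y less 2 by (auto simp: moves_eq less_prod_def)
    then have "(a m, b m) - prod.swap y \<notin> P_positions G"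
      by (rule main[OF 2(1)])
    moreover have "(a m, b m) - prod.swap y = prod.swap (x - y)"
      using 2 by (cases y) simp
    ultimately show ?thesis
      using swap_P_iff by simp
  qed
qed

end

theorem theorem1p2:
  fixes a b :: "nat \<Rightarrow> nat" and G :: game
  assumes "\<And>n. n \<ge> 1 \<Longrightarrow> a n > 0" and "\<And>n. n \<ge> 1 \<Longrightarrow> b n > 0"
    and "a 0 = 0" and "b 0 = 0"
    and "SAC (b 1) a b"
    and "is_invariant G"
    and "moves G = {(a n, b n) | n. n \<ge> 1} \<union> {(b n, a n) | n. n \<ge> 1}"
  shows "P_positions (star G) = moves G \<union> {(0, 0)} \<and> star (star G) = G"
proof -
  interpret SAC_game a b G
    by unfold_locales (fact assms)+
  have "P_positions (star G) = moves G \<union> {(0, 0)}"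
    by (rule P_positions_star[OF inv diff_moves_not_P])
  then show ?thesis
    using star_star_eq[OF inv] by blast
qed

end
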